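(* Suppose $n=6m + r$ for some $r \in\{0,1,2,3,4,5\}$ and $m\in \mathbb{N}$, with $n\geq 7$. Then: if $r=0$, $c_2(n,K_4^-)\in\{2m-1,\,2m\}$; if $r\in\{1,2\}$, $c_2(n,K_4^-)=2m$; if $r\in\{3,4\}$, $c_2(n,K_4^-)\in\{2m,\,2m+1\}$; if $r=5$, $c_2(n,K_4^-)=2m+1$. In particular, $c_2(K_4^-)=\frac{1}{3}$.
   Context: A $3$-graph $G=(V,E)$ consists of a finite vertex set $V$ and a set $E$ of $3$-element subsets of $V$ (its edges). A copy of $F$ in $G$ is a (not necessarily induced) subgraph of $G$ isomorphic to $F$. The codegree $d(x,y)$ of a pair of distinct vertices is the number of edges containing both $x$ and $y$, and $\delta_2(G)$ is the minimum of $d(x,y)$ over all pairs of distinct vertices. $G$ has an $F$-covering if every vertex of $G$ lies in at least one copy of $F$ in $G$. For a $3$-graph $F$ with at least one edge and an integer $n\ge |V(F)|$, $$c_2(n,F)=\max\{\delta_2(G): |V(G)|=n \text{ and } G \text{ does not have an } F\text{-covering}\},$$ and $c_2(F)=\lim_{n\to\infty}\frac{c_2(n,F)}{n-2}$ (this limit exists). $K_4^-$ denotes the $3$-graph on $4$ vertices with exactly three edges (the complete $3$-graph $K_4$ with one edge removed). *)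

theory Defs
  imports Complex_Main
begin

text \<open>A 3-graph is a pair of a vertex set and an edge set, subject to the predicate
  \<open>three_graph\<close>.\<close>

type_synonym 'a hgraph = "'a set \<times> 'a set set"

abbreviation verts :: "'a hgraph \<Rightarrow> 'a set" where "verts G \<equiv> fst G"
abbreviation edges :: "'a hgraph \<Rightarrow> 'a set set" where "edges G \<equiv> snd G"

definition three_graph :: "'a hgraph \<Rightarrow> bool" where
  "three_graph G \<longleftrightarrow> finite (verts G) \<and> (\<forall>e\<in>edges G. e \<subseteq> verts G \<and> card e = 3)"

definition subgraph :: "'a hgraph \<Rightarrow> 'a hgraph \<Rightarrow> bool" where
  "subgraph H G \<longleftrightarrow> three_graph H \<and> verts H \<subseteq> verts G \<and> edges H \<subseteq> edges G"

definition isomorphic :: "'a hgraph \<Rightarrow> 'b hgraph \<Rightarrow> bool" where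
  "isomorphic F H \<longleftrightarrow>
     (\<exists>f. bij_betw f (verts F) (verts H) \<and> edges H = (\<lambda>e. f ` e) ` edges F)"

definition is_copy :: "'a hgraph \<Rightarrow> 'b hgraph \<Rightarrow> 'b hgraph \<Rightarrow> bool" where
  "is_copy F H G \<longleftrightarrow> subgraph H G \<and> isomorphic F H"

definition has_covering :: "'a hgraph \<Rightarrow> 'b hgraph \<Rightarrow> bool" where
  "has_covering F G \<longleftrightarrow> (\<forall>v\<in>verts G. \<exists>H. is_copy F H G \<and> v \<in> verts H)"

definition codegree :: "'a hgraph \<Rightarrow> 'a \<Rightarrow> 'a \<Rightarrow> nat" where
  "codegree G x y = card {e \<in> edges G. x \<in> e \<and> y \<in> e}"

text \<open>Only meaningful for graphs with at least two vertices.\<close>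

definition min_codegree :: "'a hgraph \<Rightarrow> nat" where
  "min_codegree G = Min {codegree G x y | x y. x \<in> verts G \<and> y \<in> verts G \<and> x \<noteq> y}"

text \<open>Host graphs have natural numbers as vertices. This loses nothing, since every finite
  3-graph is isomorphic to one of this form.\<close>

definition noncovering_codegrees :: "nat \<Rightarrow> 'a hgraph \<Rightarrow> nat set" where
  "noncovering_codegrees n F =
     {min_codegree G | G :: nat hgraph.
        three_graph G \<and> card (verts G) = n \<and> \<not> has_covering F G}"

definition c2 :: "nat \<Rightarrow> 'a hgraph \<Rightarrow> nat" where
  "c2 n F = Max (noncovering_codegrees n F)"

text \<open>The maximum is taken over a finite nonempty set, so it is attained.\<close>

lemma finite_noncovering_codegrees:
  assumes "n \<ge> 2"
  shows "finite (noncovering_codegrees n F)"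
proof (rule finite_subset)
  show "noncovering_codegrees n F \<subseteq> {..2 ^ n}"
  proof
    fix d assume "d \<in> noncovering_codegrees n F"
    then obtain G :: "nat hgraph" where G: "three_graph G" "card (verts G) = n"
      and d: "d = min_codegree G"
      by (auto simp: noncovering_codegrees_def)
    have fV: "finite (verts G)" using G(1) by (simp add: three_graph_def)
    have "\<not> is_singleton (verts G)" "verts G \<noteq> {}"
      using G(2) assms by (auto simp: is_singleton_altdef)
    then obtain x y where xy: "x \<in> verts G" "y \<in> verts G" "x \<noteq> y"
      by (metis all_not_in_conv is_singletonI')
    have "{codegree G x y | x y. x \<in> verts G \<and> y \<in> verts G \<and> x \<noteq> y}
            \<subseteq> (\<lambda>(x, y). codegree G x y) ` (verts G \<times> verts G)"
      by auto
    then have "finite {codegree G x y | x y. x \<in> verts G \<and> y \<in> verts G \<and> x \<noteq> y}"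
      by (rule finite_subset) (use fV in simp)
    then have "d \<le> codegree G x y"
      unfolding d min_codegree_def using xy by (intro Min_le) auto
    also have "\<dots> \<le> card (Pow (verts G))"
      unfolding codegree_def using G(1) by (intro card_mono) (auto simp: three_graph_def)
    also have "\<dots> = 2 ^ n" using fV G(2) by (simp add: card_Pow)
    finally show "d \<in> {..2 ^ n}" by simp
  qed
qed simp

lemma noncovering_codegrees_nonempty:
  assumes "n \<ge> 1" "edges F \<noteq> {}"
  shows "noncovering_codegrees n F \<noteq> {}"
proof -
  let ?G = "({..<n}, {}) :: nat hgraph"
  have "0 \<in> verts ?G" using assms(1) by simp
  moreover have "\<not> is_copy F H ?G" for H
    using assms(2) by (auto simp: is_copy_def subgraph_def isomorphic_def)
  ultimately have "\<not> has_covering F ?G"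
    unfolding has_covering_def by blast
  then have "min_codegree ?G \<in> noncovering_codegrees n F"
    unfolding noncovering_codegrees_def by (force simp: three_graph_def)
  then show ?thesis by blast
qed

definition c2_ratio :: "'a hgraph \<Rightarrow> nat \<Rightarrow> real" where
  "c2_ratio F n = real (c2 n F) / (real n - 2)"

definition c2_limit :: "'a hgraph \<Rightarrow> real" where
  "c2_limit F = lim (c2_ratio F)"

definition K4_minus :: "nat hgraph" where
  "K4_minus = ({0, 1, 2, 3}, {{0, 1, 2}, {0, 1, 3}, {0, 2, 3}})"

end

theory Submission
  imports Defs "HOL-Real_Asymp.Real_Asymp"
begin

text \<open>
  Fix a vertex \<open>x\<close> and consider its link, the graph of all pairs \<open>ab\<close> such that \<open>xab\<close> is an edge.
  A copy of \<open>K\<^sub>4\<^sup>-\<close> through \<open>x\<close> is either a triangle of the link or a path \<open>bac\<close> of the link whose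
  vertices form an edge (\<open>K4_minus_through_vertex_iff\<close>). Everything follows from this description.

  For the upper bound, let \<open>x\<close> be uncovered and \<open>xyz\<close> an edge. A vertex that completes two of the
  pairs \<open>xy\<close>, \<open>xz\<close>, \<open>yz\<close> to an edge would create such a copy, so the sets of vertices counted
  by the three codegrees are disjoint and \<open>3\<delta> \<le> n\<close> (\<open>uncovered_min_codegree_le\<close>).

  For the lower bound, start from a triangle-free graph \<open>L\<close> on \<open>N = n - 1\<close> vertices, make it the link
  of a new vertex, and add every triple of old vertices that contains at most one edge of \<open>L\<close>. The
  new vertex is uncovered (\<open>cone_no_covering\<close>). A pair formed by the new vertex and \<open>a\<close> has
  codegree \<open>deg a\<close>, and an edge \<open>ab\<close> of \<open>L\<close> has codegree at least \<open>N + 1 - deg a - deg b\<close>, so all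
  degrees in \<open>L\<close> should be close to \<open>N / 3\<close>
  (\<open>min_codegree_cone_ge\<close>). A hexagon whose vertices are replaced by independent sets of
  nearly equal sizes is such a graph: every vertex sees two of the six classes.
  It yields \<open>\<delta> \<ge> (n - 1) div 6 + (n + 1) div 6\<close>. Comparing this with \<open>n div 3\<close> in each
  residue class of \<open>n\<close> modulo 6 gives the stated values, and both bounds are \<open>n / 3 + O(1)\<close>.
\<close>

section \<open>Copies through a vertex, and codegrees\<close>

text \<open>
  If \<open>v\<close> is the vertex of degree three in the copy, the edge avoiding \<open>v\<close> is the missing one and the
  other three vertices form a triangle in the link of \<open>v\<close>. Otherwise the vertex of degree three is a
  neighbour \<open>a\<close> of \<open>v\<close> in the link, and \<open>v\<close>, \<open>b\<close>, \<open>c\<close> are the three vertices of degree two.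
\<close>

lemma K4_minus_through_vertex_iff:
  assumes "three_graph G"
  shows "(\<exists>H. is_copy K4_minus H G \<and> v \<in> verts H) \<longleftrightarrow>
    (\<exists>a b c. b \<noteq> c \<and> {v, a, b} \<in> edges G \<and> {v, a, c} \<in> edges G \<and>
       ({v, b, c} \<in> edges G \<or> {a, b, c} \<in> edges G))"
    (is "?L \<longleftrightarrow> ?R")
proof
  assume ?L
  then obtain H f where HG: "edges H \<subseteq> edges G" and v: "v \<in> verts H"
    and f: "bij_betw f {0, 1, 2, 3 :: nat} (verts H)"
    and EH: "edges H = (\<lambda>e. f ` e) ` {{0, 1, 2}, {0, 1, 3}, {0, 2, 3}}"
    by (auto simp: is_copy_def subgraph_def isomorphic_def K4_minus_def)
  have E: "{f 0, f 1, f 2} \<in> edges G" "{f 0, f 1, f 3} \<in> edges G" "{f 0, f 2, f 3} \<in> edges G"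
    using HG EH by auto
  have inj: "f 1 \<noteq> f 2" "f 1 \<noteq> f 3" "f 2 \<noteq> f 3"
    using f by (auto simp: bij_betw_def inj_on_def)
  have "v \<in> f ` {0, 1, 2, 3}" using f v by (simp add: bij_betw_def)
  then consider "v = f 0" | "v = f 1" | "v = f 2" | "v = f 3" by auto
  then show ?R
  proof cases
    case 1
    then show ?thesis using E inj
      by (intro exI[of _ "f 1"] exI[of _ "f 2"] exI[of _ "f 3"]) (simp add: insert_commute)
  next
    case 2
    then show ?thesis using E inj
      by (intro exI[of _ "f 0"] exI[of _ "f 2"] exI[of _ "f 3"]) (simp add: insert_commute)
  next
    case 3
    then show ?thesis using E inj
      by (intro exI[of _ "f 0"] exI[of _ "f 1"] exI[of _ "f 3"]) (simp add: insert_commute)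
  next
    case 4
    then show ?thesis using E inj
      by (intro exI[of _ "f 0"] exI[of _ "f 1"] exI[of _ "f 2"]) (simp add: insert_commute)
  qed
next
  \<comment> \<open>Here \<open>p\<close> has degree three; it will be \<open>v\<close> in the first case below and \<open>a\<close> in the second.\<close>
  have copy: "\<exists>H. is_copy K4_minus H G \<and> verts H = {p, q, s, t}"
    if E: "{p, q, s} \<in> edges G" "{p, q, t} \<in> edges G" "{p, s, t} \<in> edges G" for p q s t
  proof -
    let ?H = "({p, q, s, t}, {{p, q, s}, {p, q, t}, {p, s, t}})"
    let ?f = "\<lambda>i::nat. if i = 0 then p else if i = 1 then q else if i = 2 then s else t"
    have card: "card {p, q, s} = 3" "card {p, q, t} = 3" "card {p, s, t} = 3"
      using assms E by (auto simp: three_graph_def)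
    then have dist: "p \<noteq> q" "p \<noteq> s" "p \<noteq> t" "q \<noteq> s" "q \<noteq> t" "s \<noteq> t"
      by (auto simp: card_insert_if split: if_splits)
    have "subgraph ?H G"
      using assms E card by (auto simp: subgraph_def three_graph_def)
    moreover have "isomorphic K4_minus ?H"
      unfolding isomorphic_def K4_minus_def
      by (rule exI[of _ ?f]) (use dist in \<open>auto simp: bij_betw_def inj_on_def\<close>)
    ultimately show ?thesis by (intro exI[of _ ?H]) (simp add: is_copy_def)
  qed
  assume ?R
  then obtain a b c where E: "{v, a, b} \<in> edges G" "{v, a, c} \<in> edges G"
    and "{v, b, c} \<in> edges G \<or> {a, b, c} \<in> edges G" by auto
  then consider "{v, b, c} \<in> edges G" | "{a, v, b} \<in> edges G" "{a, v, c} \<in> edges G" "{a, b, c} \<in> edges G"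
    by (auto simp: insert_commute)
  then show ?L
  proof cases
    case 1
    then show ?thesis using copy[OF E] by blast
  next
    case 2
    then show ?thesis using copy[OF 2] by blast
  qed
qed

text \<open>
  Counting third vertices instead of edges makes it possible to compare codegrees of
  different pairs as sizes of subsets of the vertex set.
\<close>

lemma codegree_eq_card_third_vertices:
  assumes "three_graph G" "x \<noteq> y"
  shows "codegree G x y = card {z. {x, y, z} \<in> edges G}"
proof -
  let ?Z = "{z. {x, y, z} \<in> edges G}"
  have third: "z \<noteq> x \<and> z \<noteq> y" if "z \<in> ?Z" for z
  proof -
    have "card {x, y, z} = 3" using assms(1) that by (auto simp: three_graph_def)
    then show ?thesis by (auto simp: card_insert_if split: if_splits)
  qed
  have "\<exists>z. e = {x, y, z}" if "e \<in> edges G" "x \<in> e" "y \<in> e" for e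
  proof -
    have "card e = 3" using assms(1) that(1) by (simp add: three_graph_def)
    then have "card (e - {x, y}) = 1" using that(2,3) assms(2) by (simp add: card_Diff_subset)
    then obtain z where "e - {x, y} = {z}" by (auto simp: card_1_singleton_iff)
    then show ?thesis using that(2,3) by blast
  qed
  then have "{e \<in> edges G. x \<in> e \<and> y \<in> e} = (\<lambda>z. {x, y, z}) ` ?Z" by auto
  moreover have "inj_on (\<lambda>z. {x, y, z}) ?Z"
    using third by (intro inj_onI) blast
  ultimately show ?thesis by (simp add: codegree_def card_image)
qed

lemma finite_codegrees:
  assumes "finite (verts G)"
  shows "finite {codegree G x y | x y. x \<in> verts G \<and> y \<in> verts G \<and> x \<noteq> y}"
  by (rule finite_subset[of _ "(\<lambda>(x, y). codegree G x y) ` (verts G \<times> verts G)"])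
    (use assms in auto)

lemma min_codegree_le:
  assumes "finite (verts G)" "x \<in> verts G" "y \<in> verts G" "x \<noteq> y"
  shows "min_codegree G \<le> codegree G x y"
  unfolding min_codegree_def using assms by (intro Min_le finite_codegrees) auto

section \<open>The upper bound\<close>

text \<open>
  In an edge through an uncovered vertex, the three pairs have disjoint sets of third vertices:
  two of the pairs with a common third vertex \<open>w\<close> would give, together with the edge itself,
  three of the four triples on the edge and \<open>w\<close>.
\<close>

lemma uncovered_min_codegree_le:
  assumes G: "three_graph G" and n: "card (verts G) \<ge> 2"
    and unc: "\<not> has_covering K4_minus G"
  shows "3 * min_codegree G \<le> card (verts G)"
proof (cases "min_codegree G = 0")
  case False
  have fin: "finite (verts G)" using G by (simp add: three_graph_def)
  obtain x where x: "x \<in> verts G"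
    and no: "\<And>a b c. \<lbrakk>b \<noteq> c; {x, a, b} \<in> edges G; {x, a, c} \<in> edges G\<rbrakk>
      \<Longrightarrow> {x, b, c} \<notin> edges G \<and> {a, b, c} \<notin> edges G"
    using unc K4_minus_through_vertex_iff[OF G] unfolding has_covering_def by metis
  define T where "T p q = {z. {p, q, z} \<in> edges G}" for p q
  have T: "min_codegree G \<le> card (T p q)" if "p \<in> verts G" "q \<in> verts G" "p \<noteq> q" for p q
    using min_codegree_le[OF fin that] codegree_eq_card_third_vertices[OF G that(3)]
    by (simp add: T_def)
  have TV: "T p q \<subseteq> verts G" for p q using G by (auto simp: T_def three_graph_def)
  have dist: "p \<noteq> q \<and> p \<noteq> s \<and> q \<noteq> s" if "{p, q, s} \<in> edges G" for p q s
  proof -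
    have "card {p, q, s} = 3" using G that by (auto simp: three_graph_def)
    then show ?thesis by (auto simp: card_insert_if split: if_splits)
  qed
  obtain y where y: "y \<in> verts G" "y \<noteq> x"
  proof -
    have "card (verts G - {x}) \<noteq> 0" using n x by simp
    then show thesis using that by (metis DiffE card.empty ex_in_conv insertI1)
  qed
  \<comment> \<open>Positive minimum codegree provides an edge \<open>xyz\<close>, whichever \<open>y\<close> was chosen.\<close>
  have "card (T x y) \<noteq> 0" using T[OF x y(1)] y(2) False by fastforce
  then obtain z where xyz: "{x, y, z} \<in> edges G" by (force simp: T_def)
  then have z: "z \<in> verts G" "z \<noteq> x" "z \<noteq> y" "{x, z, y} \<in> edges G"
    using G dist[OF xyz] by (auto simp: three_graph_def insert_commute)
  have "T x y \<inter> T x z = {}" "T x y \<inter> T y z = {}" "T x z \<inter> T y z = {}"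
  proof -
    show "T x y \<inter> T x z = {}"
      using no[OF _ xyz] dist unfolding T_def by fastforce
    show "T x y \<inter> T y z = {}"
      using no[OF _ xyz] dist unfolding T_def by fastforce
    show "T x z \<inter> T y z = {}"
      using no[OF _ z(4)] dist unfolding T_def by (fastforce simp: insert_commute)
  qed
  then have "card (T x y \<union> T x z \<union> T y z) = card (T x y) + card (T x z) + card (T y z)"
    using TV fin by (metis Int_Un_distrib2 Un_empty card_Un_disjoint finite_Un finite_subset)
  moreover have "card (T x y \<union> T x z \<union> T y z) \<le> card (verts G)"
    using TV fin by (intro card_mono) auto
  ultimately show ?thesis
    using T[OF x y(1) y(2)[symmetric]] T[OF x z(1) z(2)[symmetric]] T[OF y(1) z(1) z(3)[symmetric]]
    by linarith
qed simp

section \<open>The cone over a triangle-free graph\<close>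

text \<open>
  The apex \<open>N\<close> has link \<open>adj\<close> on \<open>{..<N}\<close>. Two edges of \<open>adj\<close> inside a triple share a vertex,
  so a triple contains at most one of them exactly if none of its vertices is adjacent to both
  of the others. These are the triples that can be added without creating a copy
  of \<open>K\<^sub>4\<^sup>-\<close> through the apex.
\<close>

definition cone :: "nat \<Rightarrow> (nat \<Rightarrow> nat \<Rightarrow> bool) \<Rightarrow> nat hgraph" where
  "cone N adj = ({..N}, {e. e \<subseteq> {..N} \<and> card e = 3 \<and>
     (if N \<in> e then \<forall>a\<in>e - {N}. \<forall>b\<in>e - {N}. a \<noteq> b \<longrightarrow> adj a b
      else \<not> (\<exists>a\<in>e. \<forall>b\<in>e - {a}. adj a b))})"

lemma three_graph_cone: "three_graph (cone N adj)"
  by (auto simp: three_graph_def cone_def)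

lemma verts_cone [simp]: "verts (cone N adj) = {..N}"
  by (simp add: cone_def)

lemma cone_edge_apex:
  assumes "symp adj" "irreflp adj"
  shows "{N, a, b} \<in> edges (cone N adj) \<longleftrightarrow> a < N \<and> b < N \<and> adj a b"
proof (cases "a = b \<or> a = N \<or> b = N")
  case True
  then have "card {N, a, b} \<noteq> 3" by (auto simp: card_insert_if)
  then show ?thesis using True assms(2) by (auto simp: cone_def irreflp_def)
next
  case False
  then show ?thesis using assms by (auto simp: cone_def card_insert_if symp_def)
qed

lemma cone_edge_base:
  assumes "symp adj" "a < N" "b < N" "c < N"
  shows "{a, b, c} \<in> edges (cone N adj) \<longleftrightarrow> a \<noteq> b \<and> a \<noteq> c \<and> b \<noteq> c \<and>
    \<not> (adj a b \<and> adj a c) \<and> \<not> (adj a b \<and> adj b c) \<and> \<not> (adj a c \<and> adj b c)"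
proof (cases "a = b \<or> a = c \<or> b = c")
  case True
  then have "card {a, b, c} \<noteq> 3" by (auto simp: card_insert_if)
  then show ?thesis using True by (auto simp: cone_def)
next
  case False
  then have "card {a, b, c} = 3" by simp
  moreover have "{a, b, c} - {a} = {b, c}" "{a, b, c} - {b} = {a, c}" "{a, b, c} - {c} = {a, b}"
    using False by auto
  ultimately show ?thesis using False assms by (auto simp: cone_def dest: sympD)
qed

lemma cone_no_covering:
  assumes sym: "symp adj" and irr: "irreflp adj"
    and tri: "\<And>a b c. \<lbrakk>adj a b; adj a c\<rbrakk> \<Longrightarrow> \<not> adj b c"
  shows "\<not> has_covering K4_minus (cone N adj)"
proof -
  have "\<not> (\<exists>H. is_copy K4_minus H (cone N adj) \<and> N \<in> verts H)"
    unfolding K4_minus_through_vertex_iff[OF three_graph_cone]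
  proof
    assume "\<exists>a b c. b \<noteq> c \<and> {N, a, b} \<in> edges (cone N adj) \<and> {N, a, c} \<in> edges (cone N adj) \<and>
      ({N, b, c} \<in> edges (cone N adj) \<or> {a, b, c} \<in> edges (cone N adj))"
    then obtain a b c where ab: "a < N" "b < N" "adj a b" and ac: "c < N" "adj a c"
      and E: "adj b c \<or> {a, b, c} \<in> edges (cone N adj)"
      unfolding cone_edge_apex[OF sym irr] by blast
    have "\<not> adj b c" using tri[OF ab(3) ac(2)] .
    moreover have "{a, b, c} \<notin> edges (cone N adj)"
      unfolding cone_edge_base[OF sym ab(1,2) ac(1)] using ab ac by blast
    ultimately show False using E by blast
  qed
  then show ?thesis unfolding has_covering_def by auto
qed

text \<open>
  The three degree hypotheses serve the three kinds of pairs. An apex pair \<open>Na\<close> has codegree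
  \<open>deg a\<close>. An adjacent pair \<open>ab\<close> is completed by the apex and by every vertex adjacent to neither,
  of which there are at least \<open>N - deg a - deg b\<close>. A nonadjacent pair \<open>ab\<close> is completed by every
  other vertex that is not adjacent to \<open>a\<close>, since then only \<open>b\<close> and the third vertex
  can be adjacent.
\<close>

lemma min_codegree_cone_ge:
  assumes sym: "symp adj" and irr: "irreflp adj" and "N \<ge> 1"
    and min_deg: "\<And>a. a < N \<Longrightarrow> d \<le> card {w. w < N \<and> adj a w}"
    and edge_sum: "\<And>a b. \<lbrakk>a < N; b < N; adj a b\<rbrakk> \<Longrightarrow>
      card {w. w < N \<and> adj a w} + card {w. w < N \<and> adj b w} + d \<le> N + 1"
    and max_deg: "\<And>a. a < N \<Longrightarrow> card {w. w < N \<and> adj a w} + d + 2 \<le> N"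
  shows "d \<le> min_codegree (cone N adj)"
proof -
  let ?G = "cone N adj"
  let ?nb = "\<lambda>a. {w. w < N \<and> adj a w}"
  have codeg: "codegree ?G x y = card {z. {x, y, z} \<in> edges ?G}" if "x \<noteq> y" for x y
    using codegree_eq_card_third_vertices[OF three_graph_cone that] .
  have fin: "finite {z. {x, y, z} \<in> edges ?G}" for x y
    by (rule finite_subset[of _ "{..N}"]) (auto simp: cone_def)
  have apex: "d \<le> codegree ?G N a" if "a < N" for a
    using min_deg[OF that] that by (simp add: codeg cone_edge_apex[OF sym irr])
  have base: "d \<le> codegree ?G a b" if ab: "a < N" "b < N" "a \<noteq> b" for a b
  proof (cases "adj a b")
    case True
    let ?S = "{..<N} - (?nb a \<union> ?nb b)"
    have "insert N ?S \<subseteq> {z. {a, b, z} \<in> edges ?G}"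
    proof
      fix z assume z: "z \<in> insert N ?S"
      show "z \<in> {z. {a, b, z} \<in> edges ?G}"
      proof (cases "z = N")
        case True
        then show ?thesis
          using \<open>adj a b\<close> ab cone_edge_apex[OF sym irr, of N a b] by (simp add: insert_commute)
      next
        case False
        then have "z < N" "\<not> adj a z" "\<not> adj b z" using z by auto
        \<comment> \<open>As \<open>a\<close> and \<open>b\<close> are adjacent, each lies in the neighbourhood of the other.\<close>
        moreover have "z \<noteq> a" "z \<noteq> b"
          using calculation True sym by (auto dest: sympD)
        ultimately show ?thesis using ab by (auto simp: cone_edge_base[OF sym])
      qed
    qed
    then have "card (insert N ?S) \<le> codegree ?G a b"
      unfolding codeg[OF ab(3)] by (rule card_mono[OF fin])
    moreover have "card (insert N ?S) = card ?S + 1" by simp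
    moreover have "card ?S \<ge> N - card (?nb a \<union> ?nb b)"
      using diff_card_le_card_Diff[of "?nb a \<union> ?nb b" "{..<N}"] by simp
    moreover have "card (?nb a \<union> ?nb b) \<le> card (?nb a) + card (?nb b)" by (rule card_Un_le)
    ultimately show ?thesis using edge_sum[OF ab(1,2) True] by linarith
  next
    case False
    let ?S = "{..<N} - (?nb a \<union> {a, b})"
    have "?S \<subseteq> {z. {a, b, z} \<in> edges ?G}"
      using ab False by (auto simp: cone_edge_base[OF sym])
    then have "card ?S \<le> codegree ?G a b"
      unfolding codeg[OF ab(3)] by (rule card_mono[OF fin])
    moreover have "card ?S \<ge> N - card (?nb a \<union> {a, b})"
      using diff_card_le_card_Diff[of "?nb a \<union> {a, b}" "{..<N}"] by simp
    moreover have "card (?nb a \<union> {a, b}) \<le> card (?nb a) + 2"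
      using card_Un_le[of "?nb a" "{a, b}"] ab(3) by simp
    ultimately show ?thesis using max_deg[OF ab(1)] by linarith
  qed
  have "d \<le> codegree ?G x y" if xy: "x \<le> N" "y \<le> N" "x \<noteq> y" for x y
  proof (cases "x = N \<or> y = N")
    case True
    moreover have "codegree ?G x y = codegree ?G y x"
      by (simp add: codegree_def conj_commute)
    ultimately show ?thesis using apex xy by (metis le_neq_implies_less)
  next
    case False
    then show ?thesis using base xy by simp
  qed
  moreover have "codegree ?G 0 N \<in> {codegree ?G x y | x y. x \<in> verts ?G \<and> y \<in> verts ?G \<and> x \<noteq> y}"
    using \<open>N \<ge> 1\<close> by force
  ultimately show ?thesis
    unfolding min_codegree_def
    by (intro Min.boundedI finite_codegrees) auto
qed

section \<open>The blow-up of the hexagon\<close>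

text \<open>
  Restricted to \<open>{..<N}\<close>, this is the blow-up of the 6-cycle in which vertex \<open>r\<close> is replaced by
  the residue class of \<open>r\<close>. Which classes are the larger ones matters for the degrees:
  they are the consecutive classes \<open>0, \<dots>, N mod 6 - 1\<close>.
\<close>

definition hexagon :: "nat \<Rightarrow> nat \<Rightarrow> bool" where
  "hexagon a b \<longleftrightarrow> (a + 1) mod 6 = b mod 6 \<or> (b + 1) mod 6 = a mod 6"

text \<open>The 6-cycle is bipartite, so the blow-up has neither loops nor triangles.\<close>

lemma hexagon_parity:
  assumes "hexagon a b"
  shows "even a \<noteq> even b"
proof -
  have "even (x mod 6) \<longleftrightarrow> even x" for x :: nat by (simp add: dvd_mod_iff)
  then show ?thesis using assms unfolding hexagon_def by (metis even_plus_one_iff)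
qed

lemma symp_hexagon: "symp hexagon" and irreflp_hexagon: "irreflp hexagon"
  using hexagon_parity by (auto simp: symp_def hexagon_def irreflp_def)

lemma hexagon_iff: "hexagon a b \<longleftrightarrow> b mod 6 = (a + 1) mod 6 \<or> b mod 6 = (a + 5) mod 6"
proof -
  have "(b + 1) mod 6 = a mod 6 \<longleftrightarrow> b mod 6 = (a + 5) mod 6"
  proof
    assume "(b + 1) mod 6 = a mod 6"
    then have "(b + 1 + 5) mod 6 = (a + 5) mod 6" by (rule mod_add_cong) simp
    then show "b mod 6 = (a + 5) mod 6" by simp
  next
    assume "b mod 6 = (a + 5) mod 6"
    then have "(b + 1) mod 6 = (a + 5 + 1) mod 6" by (rule mod_add_cong) simp
    then show "(b + 1) mod 6 = a mod 6" by simp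
  qed
  then show ?thesis unfolding hexagon_def by auto
qed

lemma card_residue_class:
  assumes "r < 6"
  shows "card {w. w < N \<and> w mod 6 = r} = N div 6 + of_bool (r < N mod 6)"
proof (induction N)
  case 0
  then show ?case by simp
next
  case (Suc N)
  have "{w. w < Suc N \<and> w mod 6 = r} =
      (if N mod 6 = r then insert N {w. w < N \<and> w mod 6 = r} else {w. w < N \<and> w mod 6 = r})"
    by (auto simp: less_Suc_eq)
  then have "card {w. w < Suc N \<and> w mod 6 = r} =
      N div 6 + of_bool (r < N mod 6) + of_bool (N mod 6 = r)"
    using Suc by simp
  also have "\<dots> = Suc N div 6 + of_bool (r < Suc N mod 6)"
    using assms by (auto simp: div_Suc mod_Suc of_bool_def)
  finally show ?case .
qed

lemma hexagon_degree:
  "card {w. w < N \<and> hexagon a w} =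
    2 * (N div 6) + of_bool ((a + 1) mod 6 < N mod 6) + of_bool ((a + 5) mod 6 < N mod 6)"
proof -
  have "{w. w < N \<and> hexagon a w} =
      {w. w < N \<and> w mod 6 = (a + 1) mod 6} \<union> {w. w < N \<and> w mod 6 = (a + 5) mod 6}"
    by (auto simp: hexagon_iff)
  moreover have "(a + 1) mod 6 \<noteq> (a + 5) mod 6" by presburger
  then have "{w. w < N \<and> w mod 6 = (a + 1) mod 6} \<inter> {w. w < N \<and> w mod 6 = (a + 5) mod 6} = {}"
    by auto
  ultimately show ?thesis by (simp add: card_Un_disjoint card_residue_class)
qed

text \<open>
  With \<open>k = N div 6\<close> and \<open>s = N mod 6\<close>, a degree is \<open>2k\<close> plus the number of larger classes among the
  two neighbouring ones. Neighbours of class 4 lie in classes 3 and 5, and class 5 is never larger,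
  so the smallest degree is \<open>2k\<close>, or \<open>2k + 1\<close> if \<open>s \<ge> 4\<close>; this is
  \<open>N div 6 + (N + 2) div 6\<close>. The multiples of \<open>k\<close> in the three conditions of
  \<open>min_codegree_cone_ge\<close> leave an inequality between numbers of larger classes, checked for
  each residue. Nonadjacent pairs need \<open>4k + 2 \<le> 6k\<close>, which is where \<open>N \<ge> 6\<close> enters.
\<close>

lemma min_codegree_cone_hexagon:
  assumes "N \<ge> 6"
  shows "N div 6 + (N + 2) div 6 \<le> min_codegree (cone N hexagon)"
proof -
  define k s where "k = N div 6" and "s = N mod 6"
  have N: "N = 6 * k + s" and s: "s < 6" and k: "k \<ge> 1"
    using assms by (auto simp: k_def s_def div_le_mono[of 6 N 6, simplified])
  have d: "(N + 2) div 6 = k + of_bool (4 \<le> s)"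
  proof -
    have "(N + 2) div 6 = k + (s + 2) div 6" unfolding N by simp
    also have "(s + 2) div 6 = of_bool (4 \<le> s)" using s by (auto simp: of_bool_def div_if)
    finally show ?thesis .
  qed
  define u v where "u a = (a + 1) mod 6" and "v a = (a + 5) mod 6" for a :: nat
  have deg: "card {w. w < N \<and> hexagon a w} = 2 * k + of_bool (u a < s) + of_bool (v a < s)" for a
    by (simp add: hexagon_degree k_def s_def u_def v_def)
  have residues: "a mod 6 = 0 \<and> u a = 1 \<and> v a = 5 \<or> a mod 6 = 1 \<and> u a = 2 \<and> v a = 0 \<or>
      a mod 6 = 2 \<and> u a = 3 \<and> v a = 1 \<or> a mod 6 = 3 \<and> u a = 4 \<and> v a = 2 \<or>
      a mod 6 = 4 \<and> u a = 5 \<and> v a = 3 \<or> a mod 6 = 5 \<and> u a = 0 \<and> v a = 4" for a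
  proof -
    have "a mod 6 = 0 \<or> a mod 6 = 1 \<or> a mod 6 = 2 \<or> a mod 6 = 3 \<or> a mod 6 = 4 \<or> a mod 6 = 5"
      using mod_less_divisor[of 6 a] by linarith
    moreover have "u a = (a mod 6 + 1) mod 6" "v a = (a mod 6 + 5) mod 6"
      unfolding u_def v_def by (rule mod_add_left_eq[symmetric])+
    ultimately show ?thesis by (elim disjE) (simp_all del: mod_add_left_eq mod_Suc_eq)
  qed
  show ?thesis
  proof (rule min_codegree_cone_ge)
    show "symp hexagon" "irreflp hexagon" by (rule symp_hexagon irreflp_hexagon)+
    show "N \<ge> 1" using assms by simp
    show "N div 6 + (N + 2) div 6 \<le> card {w. w < N \<and> hexagon a w}" for a
      unfolding deg d k_def[symmetric] using residues[of a] s by (auto simp: of_bool_def)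
    show "card {w. w < N \<and> hexagon a w} + card {w. w < N \<and> hexagon b w}
        + (N div 6 + (N + 2) div 6) \<le> N + 1" if "hexagon a b" for a b
    proof -
      have "b mod 6 = u a \<or> b mod 6 = v a"
        using that unfolding hexagon_iff u_def v_def .
      moreover have "of_bool (u a < s) + of_bool (v a < s) + of_bool (u b < s) + of_bool (v b < s)
          + of_bool (4 \<le> s) \<le> s + 1"
        using calculation residues[of a] residues[of b] s by (auto simp: of_bool_def)
      ultimately show ?thesis
        unfolding deg d k_def[symmetric] using N by linarith
    qed
    show "card {w. w < N \<and> hexagon a w} + (N div 6 + (N + 2) div 6) + 2 \<le> N" for a
    proof -
      have "of_bool (u a < s) + of_bool (v a < s) + of_bool (4 \<le> s) \<le> s"
        using residues[of a] s by (auto simp: of_bool_def)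
      then show ?thesis
        unfolding deg d k_def[symmetric] using N k by linarith
    qed
  qed
qed

section \<open>The values and the limit\<close>

lemma c2_K4_minus_bounds:
  assumes "n \<ge> 7"
  shows "(n - 1) div 6 + (n + 1) div 6 \<le> c2 n K4_minus" and "c2 n K4_minus \<le> n div 3"
proof -
  let ?G = "cone (n - 1) hexagon"
  let ?S = "noncovering_codegrees n K4_minus"
  have fin: "finite ?S" using assms by (intro finite_noncovering_codegrees) simp
  have "\<not> has_covering K4_minus ?G"
  proof (rule cone_no_covering)
    show "symp hexagon" "irreflp hexagon" by (rule symp_hexagon irreflp_hexagon)+
    show "\<not> hexagon b c" if "hexagon a b" "hexagon a c" for a b c
      using that hexagon_parity by blast
  qed
  then have "min_codegree ?G \<in> ?S"
    using assms three_graph_cone[of "n - 1" hexagon]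
    unfolding noncovering_codegrees_def by (intro CollectI exI[of _ ?G]) simp
  then have "min_codegree ?G \<le> c2 n K4_minus"
    unfolding c2_def using fin by simp
  moreover have "(n - 1) div 6 + (n - 1 + 2) div 6 \<le> min_codegree ?G"
    using assms by (intro min_codegree_cone_hexagon) simp
  ultimately show "(n - 1) div 6 + (n + 1) div 6 \<le> c2 n K4_minus"
    using assms by simp
  have "?S \<noteq> {}" using \<open>min_codegree ?G \<in> ?S\<close> by blast
  moreover have "d \<le> n div 3" if "d \<in> ?S" for d
  proof -
    obtain G :: "nat hgraph" where "three_graph G" "card (verts G) = n"
      "\<not> has_covering K4_minus G" "d = min_codegree G"
      using \<open>d \<in> ?S\<close> unfolding noncovering_codegrees_def by blast
    then have "3 * d \<le> n" using uncovered_min_codegree_le[of G] assms by linarith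
    then show ?thesis by simp
  qed
  ultimately show "c2 n K4_minus \<le> n div 3"
    unfolding c2_def using fin by simp
qed

lemma c2_ratio_K4_minus_tendsto: "c2_ratio K4_minus \<longlonglongrightarrow> 1 / 3"
proof (rule tendsto_sandwich)
  have *: "(real n - 5) / 3 \<le> c2 n K4_minus \<and> c2 n K4_minus \<le> real n / 3" if "n \<ge> 7" for n
  proof -
    define p q where "p = (n - 1) div 6" and "q = (n + 1) div 6"
    have "n - 1 < 6 + 6 * p" "n + 1 < 6 + 6 * q"
      unfolding p_def q_def by (rule dividend_less_times_div; simp)+
    then have "n \<le> 3 * (p + q) + 5" using that by arith
    then have "n \<le> 3 * c2 n K4_minus + 5" "3 * c2 n K4_minus \<le> n"
      using c2_K4_minus_bounds[OF that] unfolding p_def q_def by linarith+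
    then have "real n \<le> 3 * real (c2 n K4_minus) + 5" "3 * real (c2 n K4_minus) \<le> real n"
      by linarith+
    then show ?thesis by (simp add: field_simps)
  qed
  show "\<forall>\<^sub>F n in sequentially. (real n - 5) / 3 / (real n - 2) \<le> c2_ratio K4_minus n"
    using eventually_ge_at_top[of 7]
    unfolding c2_ratio_def
    by eventually_elim (intro divide_right_mono; use * in simp)
  show "\<forall>\<^sub>F n in sequentially. c2_ratio K4_minus n \<le> real n / 3 / (real n - 2)"
    using eventually_ge_at_top[of 7]
    unfolding c2_ratio_def
    by eventually_elim (intro divide_right_mono; use * in simp)
  show "(\<lambda>n. (real n - 5) / 3 / (real n - 2)) \<longlonglongrightarrow> 1 / 3" by real_asymp
  show "(\<lambda>n. real n / 3 / (real n - 2)) \<longlonglongrightarrow> 1 / 3" by real_asymp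
qed

theorem theorem1p2:
  shows "(\<forall>n m r :: nat. n = 6 * m + r \<and> r \<in> {0, 1, 2, 3, 4, 5} \<and> n \<ge> 7 \<longrightarrow>
            (r = 0 \<longrightarrow> c2 n K4_minus \<in> {2 * m - 1, 2 * m}) \<and>
            (r \<in> {1, 2} \<longrightarrow> c2 n K4_minus = 2 * m) \<and>
            (r \<in> {3, 4} \<longrightarrow> c2 n K4_minus \<in> {2 * m, 2 * m + 1}) \<and>
            (r = 5 \<longrightarrow> c2 n K4_minus = 2 * m + 1)) \<and>
         convergent (c2_ratio K4_minus) \<and> c2_limit K4_minus = 1 / 3"
proof (intro conjI allI impI)
  fix n m r :: nat
  assume A: "n = 6 * m + r \<and> r \<in> {0, 1, 2, 3, 4, 5} \<and> n \<ge> 7"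
  then have n: "n = 6 * m + r" and "n \<ge> 7" by auto
  note lower = c2_K4_minus_bounds(1)[OF \<open>n \<ge> 7\<close>] and upper = c2_K4_minus_bounds(2)[OF \<open>n \<ge> 7\<close>]
  show "c2 n K4_minus \<in> {2 * m - 1, 2 * m}" if "r = 0"
  proof -
    have "2 * m - 1 \<le> (n - 1) div 6 + (n + 1) div 6" "n div 3 = 2 * m" using n that by presburger+
    then have "2 * m - 1 \<le> c2 n K4_minus" "c2 n K4_minus \<le> 2 * m" using lower upper by linarith+
    then show ?thesis by auto
  qed
  show "c2 n K4_minus = 2 * m" if "r \<in> {1, 2}"
  proof -
    have "(n - 1) div 6 + (n + 1) div 6 = 2 * m" "n div 3 = 2 * m" using n that by auto
    then show ?thesis using lower upper by linarith
  qed
  show "c2 n K4_minus \<in> {2 * m, 2 * m + 1}" if "r \<in> {3, 4}"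
  proof -
    have "(n - 1) div 6 + (n + 1) div 6 = 2 * m" "n div 3 = 2 * m + 1" using n that by auto
    then have "2 * m \<le> c2 n K4_minus" "c2 n K4_minus \<le> 2 * m + 1" using lower upper by linarith+
    then show ?thesis by auto
  qed
  show "c2 n K4_minus = 2 * m + 1" if "r = 5"
  proof -
    have "(n - 1) div 6 + (n + 1) div 6 = 2 * m + 1" "n div 3 = 2 * m + 1" using n that by auto
    then show ?thesis using lower upper by linarith
  qed
next
  show "convergent (c2_ratio K4_minus)" using c2_ratio_K4_minus_tendsto by (rule convergentI)
  show "c2_limit K4_minus = 1 / 3"
    unfolding c2_limit_def using c2_ratio_K4_minus_tendsto by (rule limI)
qed

end
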